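(* Let $\Omega\subset\mathbb{R}^N$ be an open bounded Lipschitz set and $1\le p<\infty$. Then there is a constant $c>0$, depending on $\Omega$, $N$ and $p$, such that for every $u\in L^p(\Omega)$ $$ \int_\Omega |u(x)|^p\,\ln^+\!\left(\frac{1}{\delta_x}\right)dx\le c\left(\ \iint_{\substack{\Omega\times\Omega\\ |x-y|<1}}\frac{|u(x)-u(y)|^p}{|x-y|^N}\,dy\,dx+\int_\Omega|u(x)|^p\,dx\right). $$
   Context: $\Omega$ is nonempty, $\ln^+(t)=\max\{\ln t,0\}$ for $t>0$, and $\delta_x=\mathrm{dist}(x,\partial\Omega)$. The right-hand side may be $+\infty$, in which case the inequality is trivially true. *)

theory Defs
  imports "HOL-Analysis.Analysis"
begin

text \<open>
  Near each boundary point, \<^term>\<open>\<Omega>\<close> is the strict epigraph of a Lipschitz function in some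
  orthonormal frame. The unit vector \<^term>\<open>e\<close> is the last axis of the frame; the remaining axes
  span the hyperplane orthogonal to \<^term>\<open>e\<close>, on which \<^term>\<open>g\<close> is Lipschitz.
  In dimension one this hyperplane is the origin alone and \<^term>\<open>g\<close> is a constant.
\<close>

definition Lipschitz_boundary :: "(real ^ 'n) set \<Rightarrow> bool" where
  "Lipschitz_boundary \<Omega> \<longleftrightarrow>
     (\<forall>x0 \<in> frontier \<Omega>. \<exists>r>0. \<exists>e. \<exists>L. \<exists>g :: real ^ 'n \<Rightarrow> real.
        norm e = 1 \<and>
        L-lipschitz_on {z. z \<bullet> e = 0} g \<and>
        \<Omega> \<inter> ball x0 r = {x. g (x - (x \<bullet> e) *\<^sub>R e) < x \<bullet> e} \<inter> ball x0 r)"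

definition bounded_Lipschitz_open :: "(real ^ 'n) set \<Rightarrow> bool" where
  "bounded_Lipschitz_open \<Omega> \<longleftrightarrow> open \<Omega> \<and> bounded \<Omega> \<and> Lipschitz_boundary \<Omega>"

text \<open>Functions rather than classes modulo null sets; values outside \<^term>\<open>\<Omega>\<close> are irrelevant.\<close>

definition Lp_on :: "real \<Rightarrow> (real ^ 'n) set \<Rightarrow> (real ^ 'n \<Rightarrow> real) set" where
  "Lp_on p \<Omega> = {u. u \<in> borel_measurable (lebesgue_on \<Omega>) \<and>
                   integrable (lebesgue_on \<Omega>) (\<lambda>x. \<bar>u x\<bar> powr p)}"

definition ln_plus :: "real \<Rightarrow> real" where
  "ln_plus t = max (ln t) 0"

definition bdist :: "(real ^ 'n) set \<Rightarrow> real ^ 'n \<Rightarrow> real" where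
  "bdist \<Omega> x = infdist x (frontier \<Omega>)"

end

theory Submission
  imports Defs
begin

text \<open>
  The logarithm counts dyadic scales. If \<^term>\<open>x\<close> lies at a small distance $d$ from the boundary
  of \<^term>\<open>\<Omega>\<close>, the Lipschitz condition provides a cone of fixed opening and height with vertex
  \<^term>\<open>x\<close> inside \<^term>\<open>\<Omega>\<close>. At each scale $t = 2^{-k}$ between $d$ and the height, the cone
  contains a ball of radius comparable to $t$ at distance comparable to $t$ from \<^term>\<open>x\<close>, and the
  integral of $|x-y|^{-N}$ over this ball is a constant that does not depend on $t$. There are
  about $\ln(1/d)$ such scales. So $\ln^+(1/d)$ is at most a constant times $1 + \int k(x,y)\,dy$,
  where $k(x,y) = |x-y|^{-N}$ on the pairs with $y$ at distance between $d$ and 1 from $x$, and at a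
  distance from the boundary that is at least a fixed multiple of $|x-y|$
  (\<open>ln_plus_bdist_le_inward_kernel\<close>).

  Integrating in the other variable costs nothing: for fixed \<^term>\<open>y\<close>, the points \<^term>\<open>x\<close>
  that are paired with it lie in an annulus around \<^term>\<open>y\<close> whose two radii are both comparable
  to the boundary distance of \<^term>\<open>y\<close>, and the integral of $|x-y|^{-N}$ over such an annulus is
  bounded (\<open>nn_integral_inward_kernel_le\<close>).

  It remains to multiply the first estimate by $|u(x)|^p$, to integrate, and to compare $|u(x)|^p$
  with $|u(x)-u(y)|^p + |u(y)|^p$ under the kernel. The first summand gives the double integral of
  the statement, because $k(x,y)$ is at most $|x-y|^{-N}$ and vanishes unless $|x-y|<1$. The second
  one gives, by Tonelli and the second estimate, a multiple of $\int |u|^p$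
  (\<open>nn_integral_powr_times_kernel_le\<close>).
\<close>

section \<open>Exchanging mass along a kernel\<close>

lemma sigma_finite_measure_completion:
  assumes "sigma_finite_measure M"
  shows "sigma_finite_measure (completion M)"
proof -
  obtain A where "countable A" "A \<subseteq> sets M" "\<Union>A = space M" "\<forall>a\<in>A. emeasure M a \<noteq> \<infinity>"
    using sigma_finite_measure.sigma_finite_countable[OF assms] by blast
  then show ?thesis
    by (intro sigma_finite_measure.intro exI[of _ A]) (auto simp: subset_eq)
qed

lemma powr_abs_le_diff_plus:
  fixes a b p :: real
  assumes "0 \<le> p"
  shows "\<bar>a\<bar> powr p \<le> 2 powr p * (\<bar>a - b\<bar> powr p + \<bar>b\<bar> powr p)"
proof -
  have "\<bar>a\<bar> powr p \<le> (2 * max \<bar>a - b\<bar> \<bar>b\<bar>) powr p"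
  proof (rule powr_mono2)
    have "\<bar>a\<bar> \<le> \<bar>a - b\<bar> + \<bar>b\<bar>" by linarith
    also have "\<dots> \<le> max \<bar>a - b\<bar> \<bar>b\<bar> + max \<bar>a - b\<bar> \<bar>b\<bar>"
      by (intro add_mono) simp_all
    finally show "\<bar>a\<bar> \<le> 2 * max \<bar>a - b\<bar> \<bar>b\<bar>" by simp
  qed (use assms in auto)
  also have "\<dots> = 2 powr p * max \<bar>a - b\<bar> \<bar>b\<bar> powr p"
    by (simp add: powr_mult)
  also have "\<dots> \<le> 2 powr p * (\<bar>a - b\<bar> powr p + \<bar>b\<bar> powr p)"
    by (intro mult_left_mono) (auto simp: max_def)
  finally show ?thesis .
qed

text \<open>
  Mass at \<^term>\<open>x\<close>, weighted by the outgoing mass of the kernel, is moved to the points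
  \<^term>\<open>y\<close>. The price is the oscillation of \<^term>\<open>v\<close> along the kernel, and what arrives at
  \<^term>\<open>y\<close> is controlled by the incoming mass of the kernel, which is at most \<^term>\<open>B\<close>. The
  outgoing mass may be unbounded: this asymmetry is what makes the lemma useful.
\<close>

lemma nn_integral_powr_times_kernel_le:
  fixes v :: "'a \<Rightarrow> real" and k :: "'a \<times> 'a \<Rightarrow> ennreal"
  assumes M: "sigma_finite_measure M" and "0 \<le> p"
    and v[measurable]: "v \<in> borel_measurable M"
    and k[measurable]: "k \<in> borel_measurable (M \<Otimes>\<^sub>M M)"
    and B: "\<And>y. y \<in> space M \<Longrightarrow> (\<integral>\<^sup>+x. k (x, y) \<partial>M) \<le> B"
  shows "(\<integral>\<^sup>+x. ennreal (\<bar>v x\<bar> powr p) * (\<integral>\<^sup>+y. k (x, y) \<partial>M) \<partial>M)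
    \<le> ennreal (2 powr p) *
       ((\<integral>\<^sup>+z. ennreal (\<bar>v (fst z) - v (snd z)\<bar> powr p) * k z \<partial>(M \<Otimes>\<^sub>M M))
        + B * (\<integral>\<^sup>+y. ennreal (\<bar>v y\<bar> powr p) \<partial>M))"
proof -
  interpret sigma_finite_measure M by fact
  interpret P: pair_sigma_finite M M by unfold_locales
  have "(\<integral>\<^sup>+x. ennreal (\<bar>v x\<bar> powr p) * (\<integral>\<^sup>+y. k (x, y) \<partial>M) \<partial>M)
      = (\<integral>\<^sup>+x. (\<integral>\<^sup>+y. ennreal (\<bar>v (fst (x,y))\<bar> powr p) * k (x, y) \<partial>M) \<partial>M)"
    by (intro nn_integral_cong) (simp add: nn_integral_cmult)
  also have "\<dots> = (\<integral>\<^sup>+z. ennreal (\<bar>v (fst z)\<bar> powr p) * k z \<partial>(M \<Otimes>\<^sub>M M))"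
    using nn_integral_fst[of "\<lambda>z. ennreal (\<bar>v (fst z)\<bar> powr p) * k z"] by simp
  also have "\<dots> \<le> (\<integral>\<^sup>+z. ennreal (2 powr p) * (ennreal (\<bar>v (fst z) - v (snd z)\<bar> powr p) * k z
                      + ennreal (\<bar>v (snd z)\<bar> powr p) * k z) \<partial>(M \<Otimes>\<^sub>M M))"
  proof (rule nn_integral_mono)
    fix z
    have "ennreal (\<bar>v (fst z)\<bar> powr p) * k z
      \<le> ennreal (2 powr p * (\<bar>v (fst z) - v (snd z)\<bar> powr p + \<bar>v (snd z)\<bar> powr p)) * k z"
      by (intro mult_right_mono ennreal_leI powr_abs_le_diff_plus \<open>0 \<le> p\<close>) simp
    also have "\<dots> = ennreal (2 powr p) * (ennreal (\<bar>v (fst z) - v (snd z)\<bar> powr p) * k z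
                      + ennreal (\<bar>v (snd z)\<bar> powr p) * k z)"
      by (simp add: ennreal_mult' ennreal_plus distrib_right mult.assoc)
    finally show "ennreal (\<bar>v (fst z)\<bar> powr p) * k z \<le> \<dots>" .
  qed
  also have "\<dots> = ennreal (2 powr p) *
      ((\<integral>\<^sup>+z. ennreal (\<bar>v (fst z) - v (snd z)\<bar> powr p) * k z \<partial>(M \<Otimes>\<^sub>M M))
       + (\<integral>\<^sup>+z. ennreal (\<bar>v (snd z)\<bar> powr p) * k z \<partial>(M \<Otimes>\<^sub>M M)))"
    by (subst nn_integral_cmult, measurable, subst nn_integral_add, measurable)
  also have "(\<integral>\<^sup>+z. ennreal (\<bar>v (snd z)\<bar> powr p) * k z \<partial>(M \<Otimes>\<^sub>M M))
      = (\<integral>\<^sup>+y. (\<integral>\<^sup>+x. ennreal (\<bar>v (snd (x,y))\<bar> powr p) * k (x, y) \<partial>M) \<partial>M)"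
    by (subst P.nn_integral_snd[symmetric]) (auto simp: split_beta)
  also have "\<dots> = (\<integral>\<^sup>+y. ennreal (\<bar>v y\<bar> powr p) * (\<integral>\<^sup>+x. k (x, y) \<partial>M) \<partial>M)"
    by (intro nn_integral_cong) (simp add: nn_integral_cmult)
  also have "\<dots> \<le> (\<integral>\<^sup>+y. ennreal (\<bar>v y\<bar> powr p) * B \<partial>M)"
    by (intro nn_integral_mono mult_left_mono B) auto
  also have "\<dots> = B * (\<integral>\<^sup>+y. ennreal (\<bar>v y\<bar> powr p) \<partial>M)"
    by (subst nn_integral_multc) (simp_all add: mult.commute)
  finally show ?thesis
    by (simp add: add_left_mono mult_left_mono)
qed

section \<open>The boundary distance and interior cones\<close>

lemma bdist_le_dist_plus: "bdist \<Omega> x \<le> bdist \<Omega> y + norm (x - y)"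
  using infdist_triangle[of x "frontier \<Omega>" y] by (simp add: bdist_def dist_norm)

lemma bdist_pos:
  assumes "open \<Omega>" "frontier \<Omega> \<noteq> {}" "x \<in> \<Omega>"
  shows "0 < bdist \<Omega> x"
  unfolding bdist_def
  using assms by (intro infdist_pos_not_in_closed) (auto simp: frontier_def interior_open)

lemma bdist_ge_radius:
  assumes "open \<Omega>" "frontier \<Omega> \<noteq> {}" "ball y s \<subseteq> \<Omega>"
  shows "s \<le> bdist \<Omega> y"
proof -
  have "s \<le> dist y a" if "a \<in> frontier \<Omega>" for a
    using that assms by (force simp: frontier_def interior_open not_less[symmetric])
  then show ?thesis
    using assms(2) by (auto simp: bdist_def infdist_notempty intro!: cINF_greatest)
qed

text \<open>
  The points of \<^term>\<open>\<Omega>\<close> in \<^term>\<open>U\<close> share an opening \<^term>\<open>\<epsilon>\<close> and a height \<^term>\<open>\<rho>\<close>,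
  whereas the axis of the cone may depend on the point. The cone is the union of the balls
  below. The set \<^term>\<open>U\<close> is a parameter so that local cone conditions can be glued.
\<close>

definition interior_cones :: "(real ^ 'n) set \<Rightarrow> (real ^ 'n) set \<Rightarrow> real \<Rightarrow> real \<Rightarrow> bool" where
  "interior_cones \<Omega> U \<epsilon> \<rho> \<longleftrightarrow>
     (\<forall>x \<in> \<Omega> \<inter> U. \<exists>e. norm e = 1 \<and> (\<forall>t. 0 < t \<and> t < \<rho> \<longrightarrow> ball (x + t *\<^sub>R e) (\<epsilon> * t) \<subseteq> \<Omega>))"

lemma interior_cones_mono:
  assumes "interior_cones \<Omega> U \<epsilon> \<rho>" "V \<subseteq> U" "\<epsilon>' \<le> \<epsilon>" "\<rho>' \<le> \<rho>"
  shows "interior_cones \<Omega> V \<epsilon>' \<rho>'"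
  unfolding interior_cones_def
proof
  fix x assume "x \<in> \<Omega> \<inter> V"
  then obtain e where e: "norm e = 1"
      "\<And>t. 0 < t \<Longrightarrow> t < \<rho> \<Longrightarrow> ball (x + t *\<^sub>R e) (\<epsilon> * t) \<subseteq> \<Omega>"
    using assms(1,2) unfolding interior_cones_def by blast
  have "ball (x + t *\<^sub>R e) (\<epsilon>' * t) \<subseteq> \<Omega>" if "0 < t" "t < \<rho>'" for t
  proof -
    have "ball (x + t *\<^sub>R e) (\<epsilon>' * t) \<subseteq> ball (x + t *\<^sub>R e) (\<epsilon> * t)"
      using that assms(3) by (intro subset_ball mult_right_mono) auto
    also have "\<dots> \<subseteq> \<Omega>" using that assms(4) by (intro e(2)) auto
    finally show ?thesis .
  qed
  then show "\<exists>e. norm e = 1 \<and> (\<forall>t. 0 < t \<and> t < \<rho>' \<longrightarrow> ball (x + t *\<^sub>R e) (\<epsilon>' * t) \<subseteq> \<Omega>)"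
    using e(1) by blast
qed

lemma interior_cones_Un:
  assumes "interior_cones \<Omega> U \<epsilon> \<rho>" "interior_cones \<Omega> V \<epsilon>' \<rho>'"
  shows "interior_cones \<Omega> (U \<union> V) (min \<epsilon> \<epsilon>') (min \<rho> \<rho>')"
  using interior_cones_mono[OF assms(1) order_refl, of "min \<epsilon> \<epsilon>'" "min \<rho> \<rho>'"]
    interior_cones_mono[OF assms(2) order_refl, of "min \<epsilon> \<epsilon>'" "min \<rho> \<rho>'"]
  unfolding interior_cones_def by auto

text \<open>
  The axis of the graph serves as the axis of all cones. Moving by $t$ along it raises the height
  over the graph by $t$, and a further perturbation \<^term>\<open>w\<close> changes that height by at most
  $(1+2L)|w|$; the opening is chosen so that this is less than $t$. The factor 2 absorbs the crude
  bound $2|w|$ for the norm of the projection of \<^term>\<open>w\<close>. The bound on $t$ keeps the cone inside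
  the ball in which the graph describes \<^term>\<open>\<Omega>\<close>.
\<close>

lemma interior_cones_epigraph:
  fixes e :: "real ^ 'n"
  assumes r: "0 < r" and e: "norm e = 1" and g: "L-lipschitz_on {z. z \<bullet> e = 0} g"
    and \<Omega>: "\<Omega> \<inter> ball x0 r = {x. g (x - (x \<bullet> e) *\<^sub>R e) < x \<bullet> e} \<inter> ball x0 r"
  shows "interior_cones \<Omega> (ball x0 (r / 2)) (1 / (2 * (1 + 2 * L))) (r / 4)"
  unfolding interior_cones_def
proof (intro ballI exI[of _ e] conjI e allI impI subsetI)
  define \<epsilon> where "\<epsilon> = 1 / (2 * (1 + 2 * L))"
  have L: "0 \<le> L" using g by (rule lipschitz_on_nonneg)
  have \<epsilon>: "0 < \<epsilon>" "\<epsilon> \<le> 1" "\<epsilon> * (1 + 2 * L) < 1"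
    using L by (auto simp: \<epsilon>_def divide_simps)
  have ee: "e \<bullet> e = 1" using e by (simp add: dot_square_norm)
  fix x t y
  assume x: "x \<in> \<Omega> \<inter> ball x0 (r / 2)" and t: "0 < t \<and> t < r / 4"
    and y: "y \<in> ball (x + t *\<^sub>R e) (1 / (2 * (1 + 2 * L)) * t)"
  define w where "w = y - x - t *\<^sub>R e"
  have w: "norm w < \<epsilon> * t"
    using y by (simp add: w_def \<epsilon>_def dist_norm norm_minus_commute algebra_simps)
  have yw: "y = x + t *\<^sub>R e + w" by (simp add: w_def)
  have we: "\<bar>w \<bullet> e\<bar> \<le> norm w" using Cauchy_Schwarz_ineq2[of w e] e by simp
  have "norm (y - x) \<le> norm (t *\<^sub>R e) + norm w"
    unfolding yw using norm_triangle_ineq[of "t *\<^sub>R e" w] by (simp add: add.assoc)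
  also have "\<dots> < t + \<epsilon> * t" using w e t by simp
  also have "\<dots> \<le> 2 * t" using \<epsilon> t by simp
  finally have "norm (y - x) < r / 2" using t by simp
  moreover have "dist x0 y \<le> dist x0 x + dist x y" by (rule dist_triangle)
  ultimately have yb: "y \<in> ball x0 r" using x by (simp add: dist_norm norm_minus_commute)
  let ?P = "\<lambda>x::real^'n. x - (x \<bullet> e) *\<^sub>R e"
  have P0: "?P x \<in> {z. z \<bullet> e = 0}" for x by (simp add: inner_diff_left ee)
  have "?P y - ?P x = w - (w \<bullet> e) *\<^sub>R e"
    by (simp add: yw inner_add_left ee algebra_simps)
  also have "norm \<dots> \<le> norm w + \<bar>w \<bullet> e\<bar>"
    using norm_triangle_ineq4[of w "(w \<bullet> e) *\<^sub>R e"] e by simp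
  finally have "norm (?P y - ?P x) \<le> 2 * norm w" using we by simp
  then have "L * norm (?P y - ?P x) \<le> L * (2 * norm w)"
    using L by (rule mult_left_mono)
  moreover have "dist (g (?P y)) (g (?P x)) \<le> L * dist (?P y) (?P x)"
    by (rule lipschitz_onD[OF g P0 P0])
  ultimately have "g (?P y) \<le> g (?P x) + 2 * L * norm w"
    by (simp add: dist_norm)
  moreover have "g (?P x) < x \<bullet> e"
  proof -
    have "x \<in> \<Omega> \<inter> ball x0 r" using x r by auto
    then show ?thesis unfolding \<Omega> by simp
  qed
  moreover have "y \<bullet> e \<ge> x \<bullet> e + t - norm w"
    using we by (simp add: yw inner_add_left ee)
  moreover have "norm w * (1 + 2 * L) < t"
  proof -
    have "norm w * (1 + 2 * L) \<le> \<epsilon> * t * (1 + 2 * L)"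
      using w L by (intro mult_right_mono) auto
    also have "\<dots> < t" using \<epsilon>(3) t by (simp add: mult.commute mult.left_commute)
    finally show ?thesis .
  qed
  ultimately have "g (?P y) < y \<bullet> e" by (simp add: algebra_simps)
  then have "y \<in> \<Omega> \<inter> ball x0 r" unfolding \<Omega> using yb by simp
  then show "y \<in> \<Omega>" by simp
qed

text \<open>
  Compactness of the boundary makes the local cone conditions uniform: finitely many of the balls
  from \<open>interior_cones_epigraph\<close> cover it, and hence also cover all points within some distance
  \<^term>\<open>\<delta>\<close> of it.
\<close>

lemma Lipschitz_interior_cones:
  fixes \<Omega> :: "(real ^ 'n) set"
  assumes "bounded_Lipschitz_open \<Omega>"
  obtains \<epsilon> \<rho> \<delta> where "0 < \<epsilon>" "0 < \<rho>" "0 < \<delta>" "interior_cones \<Omega> {x. bdist \<Omega> x < \<delta>} \<epsilon> \<rho>"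
proof -
  have "open \<Omega>" and bd: "bounded \<Omega>" and Lip: "Lipschitz_boundary \<Omega>"
    using assms by (auto simp: bounded_Lipschitz_open_def)
  have K: "compact (frontier \<Omega>)" using bd by (rule compact_frontier_bounded)
  let ?good = "\<lambda>U. \<exists>\<epsilon>>0. \<exists>\<rho>>0. interior_cones \<Omega> U \<epsilon> \<rho>"
  have "\<exists>s>0. ?good (ball z s)" if z: "z \<in> frontier \<Omega>" for z
  proof -
    obtain r e L g where *: "r > 0" "norm e = 1" "L-lipschitz_on {z. z \<bullet> e = 0} g"
      "\<Omega> \<inter> ball z r = {x. g (x - (x \<bullet> e) *\<^sub>R e) < x \<bullet> e} \<inter> ball z r"
      using Lip z unfolding Lipschitz_boundary_def by blast
    have "0 \<le> L" using *(3) by (rule lipschitz_on_nonneg)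
    then have "0 < 1 / (2 * (1 + 2 * L))" by simp
    moreover have "0 < r / 4" "0 < r / 2" using *(1) by auto
    ultimately show ?thesis using interior_cones_epigraph[OF *] by blast
  qed
  then obtain s where s: "\<And>z. z \<in> frontier \<Omega> \<Longrightarrow> 0 < s z \<and> ?good (ball z (s z))" by metis
  obtain C where C: "C \<subseteq> frontier \<Omega>" "finite C" "frontier \<Omega> \<subseteq> (\<Union>z\<in>C. ball z (s z))"
  proof (rule compactE_image[OF K, of "frontier \<Omega>" "\<lambda>z. ball z (s z)"])
    show "frontier \<Omega> \<subseteq> (\<Union>z\<in>frontier \<Omega>. ball z (s z))" using s by fastforce
  qed auto
  let ?U = "\<Union>z\<in>C. ball z (s z)"
  from C(2,1) have "?good ?U"
  proof (induction rule: finite_induct)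
    case empty
    show ?case by (rule exI[of _ 1], simp, rule exI[of _ 1]) (simp add: interior_cones_def)
  next
    case (insert z F)
    then obtain \<epsilon> \<rho> where 1: "\<epsilon> > 0" "\<rho> > 0" "interior_cones \<Omega> (\<Union>z\<in>F. ball z (s z)) \<epsilon> \<rho>"
      by auto
    obtain \<epsilon>' \<rho>' where 2: "\<epsilon>' > 0" "\<rho>' > 0" "interior_cones \<Omega> (ball z (s z)) \<epsilon>' \<rho>'"
      using s[of z] insert.prems by blast
    have "interior_cones \<Omega> (\<Union>z\<in>insert z F. ball z (s z)) (min \<epsilon>' \<epsilon>) (min \<rho>' \<rho>)"
      using interior_cones_Un[OF 2(3) 1(3)] by simp
    then show ?case using 1(1,2) 2(1,2) by (metis min_less_iff_conj)
  qed
  then obtain \<epsilon> \<rho> where er: "\<epsilon> > 0" "\<rho> > 0" "interior_cones \<Omega> ?U \<epsilon> \<rho>" by blast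
  show thesis
  proof (cases "frontier \<Omega> = {}")
    case True
    then have "\<Omega> = {}"
      using bd not_bounded_UNIV unfolding frontier_eq_empty by auto
    then show thesis
      by (intro that[of 1 1 1]) (auto simp: interior_cones_def)
  next
    case False
    have "open ?U" by (intro open_UN ballI open_ball)
    then obtain \<delta> where \<delta>: "\<delta> > 0" "{x. infdist x (frontier \<Omega>) \<le> \<delta>} \<subseteq> ?U"
      using compact_in_open_separated[OF False K _ C(3)] by blast
    have "interior_cones \<Omega> {x. bdist \<Omega> x < \<delta>} \<epsilon> \<rho>"
      using er(3) by (rule interior_cones_mono) (use \<delta>(2) in \<open>auto simp: bdist_def\<close>)
    with er \<delta> that show thesis by blast
  qed
qed

section \<open>A kernel from boundary points to interior points\<close>

text \<open>
  A pair leads from \<^term>\<open>x\<close> to a point \<^term>\<open>y\<close> whose distance from the boundary is comparable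
  to $|x-y|$. The lower bound for $|x-y|$ by the boundary distance of \<^term>\<open>x\<close>, and not by that of
  \<^term>\<open>y\<close>, is what is natural for counting scales at \<^term>\<open>x\<close>; the triangle inequality turns it
  into $|x-y|$ being more than half the boundary distance of \<^term>\<open>y\<close>.
\<close>

definition inward_pairs :: "real \<Rightarrow> (real ^ 'n) set \<Rightarrow> ((real ^ 'n) \<times> (real ^ 'n)) set" where
  "inward_pairs c \<Omega> = {(x, y). x \<in> \<Omega> \<and> y \<in> \<Omega> \<and> norm (x - y) < 1 \<and>
     bdist \<Omega> x < norm (x - y) \<and> c * norm (x - y) \<le> bdist \<Omega> y}"

definition inward_kernel :: "real \<Rightarrow> (real ^ 'n) set \<Rightarrow> (real ^ 'n) \<times> (real ^ 'n) \<Rightarrow> ennreal" where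
  "inward_kernel c \<Omega> z =
     ennreal (1 / norm (fst z - snd z) ^ CARD('n)) * indicator (inward_pairs c \<Omega>) z"

lemma borel_measurable_inward_kernel [measurable]:
  assumes "open \<Omega>"
  shows "inward_kernel c \<Omega> \<in> borel_measurable borel"
proof -
  have [measurable]: "\<Omega> \<in> sets borel" using assms by simp
  have [measurable]: "bdist \<Omega> \<in> borel_measurable borel"
    unfolding bdist_def by (intro borel_measurable_continuous_onI continuous_intros)
  have eq: "inward_pairs c \<Omega> = {z \<in> space (borel \<Otimes>\<^sub>M borel). fst z \<in> \<Omega> \<and> snd z \<in> \<Omega> \<and> norm (fst z - snd z) < 1 \<and>
     bdist \<Omega> (fst z) < norm (fst z - snd z) \<and> c * norm (fst z - snd z) \<le> bdist \<Omega> (snd z)}"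
    by (auto simp: inward_pairs_def space_pair_measure)
  have [measurable]: "inward_pairs c \<Omega> \<in> sets (borel \<Otimes>\<^sub>M borel)"
    unfolding eq by measurable
  have "inward_kernel c \<Omega> \<in> borel_measurable (borel \<Otimes>\<^sub>M borel)"
    unfolding inward_kernel_def[abs_def] by measurable
  then show ?thesis by (simp add: borel_prod)
qed

text \<open>
  With $d$ the boundary distance of \<^term>\<open>y\<close>, the kernel is at most $(2/d)^N$ and is supported in
  the ball of radius $d/c$ around \<^term>\<open>y\<close>, so that $d$ cancels.
\<close>

lemma nn_integral_inward_kernel_le:
  fixes \<Omega> :: "(real ^ 'n) set"
  assumes "open \<Omega>" "frontier \<Omega> \<noteq> {}" "0 < c"
  shows "(\<integral>\<^sup>+x. inward_kernel c \<Omega> (x, y) \<partial>lebesgue)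
    \<le> ennreal ((2 / c) ^ CARD('n) * unit_ball_vol (real CARD('n)))"
proof (cases "y \<in> \<Omega>")
  case False
  then show ?thesis by (simp add: inward_kernel_def inward_pairs_def)
next
  case True
  define d where "d = bdist \<Omega> y"
  have d: "0 < d" unfolding d_def using assms(1,2) True by (rule bdist_pos)
  have "inward_kernel c \<Omega> (x, y) \<le> ennreal ((2 / d) ^ CARD('n)) * indicator (cball y (d / c)) x" for x
  proof (cases "(x, y) \<in> inward_pairs c \<Omega>")
    case True
    then have 1: "bdist \<Omega> x < norm (x - y)" "c * norm (x - y) \<le> d"
      by (auto simp: inward_pairs_def d_def)
    have "d \<le> bdist \<Omega> x + norm (x - y)"
      unfolding d_def using bdist_le_dist_plus[of \<Omega> y x] by (simp add: norm_minus_commute)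
    then have far: "d / 2 < norm (x - y)" using 1 by simp
    then have "(d / 2) ^ CARD('n) \<le> norm (x - y) ^ CARD('n)"
      using d by (intro power_mono) auto
    then have "1 / norm (x - y) ^ CARD('n) \<le> 1 / (d / 2) ^ CARD('n)"
      using d by (intro divide_left_mono mult_pos_pos zero_less_power) (use far in auto)
    then have "1 / norm (x - y) ^ CARD('n) \<le> (2 / d) ^ CARD('n)"
      by (simp add: power_divide)
    moreover have "x \<in> cball y (d / c)"
      using 1(2) assms(3) by (simp add: dist_norm norm_minus_commute field_simps)
    ultimately show ?thesis
      by (simp add: inward_kernel_def True ennreal_leI)
  qed (simp add: inward_kernel_def)
  then have "(\<integral>\<^sup>+x. inward_kernel c \<Omega> (x, y) \<partial>lebesgue)
    \<le> (\<integral>\<^sup>+x. ennreal ((2 / d) ^ CARD('n)) * indicator (cball y (d / c)) x \<partial>lebesgue)"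
    by (intro nn_integral_mono)
  also have "\<dots> = ennreal ((2 / d) ^ CARD('n)) * emeasure lborel (cball y (d / c))"
    by (simp add: nn_integral_cmult_indicator nn_integral_completion)
  also have "\<dots> = ennreal ((2 / d) ^ CARD('n) * (unit_ball_vol (real CARD('n)) * (d / c) ^ CARD('n)))"
    using d assms(3) by (simp add: emeasure_cball ennreal_mult)
  also have "(2 / d) ^ CARD('n) * (unit_ball_vol (real CARD('n)) * (d / c) ^ CARD('n))
      = (2 / c) ^ CARD('n) * unit_ball_vol (real CARD('n))"
    using d by (simp add: power_divide)
  finally show ?thesis .
qed

text \<open>
  In the cone at \<^term>\<open>x\<close>, each of the first \<^term>\<open>n\<close> dyadic scales $t = \rho/2^{k+1}$
  contributes a ball of radius $\epsilon t/2$ with centre at distance $t$ from \<^term>\<open>x\<close>. Half of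
  the available radius is given up, so that the points of the ball stay at distance at least
  $\epsilon t/2$ from the boundary. On the ball the kernel is at least $(2t)^{-N}$, and the power of
  $t$ cancels against the volume. The assumption on the boundary distance of \<^term>\<open>x\<close> says that it
  is at most half of the smallest scale in use.
\<close>

lemma nn_integral_inward_kernel_ge:
  fixes \<Omega> :: "(real ^ 'n) set"
  assumes "open \<Omega>" "frontier \<Omega> \<noteq> {}"
    and \<epsilon>: "0 < \<epsilon>" "\<epsilon> \<le> 1 / 2" and \<rho>: "0 < \<rho>" "\<rho> \<le> 1 / 2"
    and "x \<in> \<Omega>" and e: "norm e = 1"
    and cone: "\<And>t. 0 < t \<Longrightarrow> t < \<rho> \<Longrightarrow> ball (x + t *\<^sub>R e) (\<epsilon> * t) \<subseteq> \<Omega>"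
    and scale: "n = 0 \<or> bdist \<Omega> x \<le> \<rho> / 2 ^ (n + 1)"
  shows "ennreal (real n * ((\<epsilon> / 4) ^ CARD('n) * unit_ball_vol (real CARD('n))))
    \<le> (\<integral>\<^sup>+y. inward_kernel (\<epsilon> / 4) \<Omega> (x, y) \<partial>lebesgue)"
proof -
  define t where "t k = \<rho> / 2 ^ (k + 1)" for k :: nat
  define b where "b k = ball (x + t k *\<^sub>R e) (\<epsilon> * t k / 2)" for k
  have t: "0 < t k" "t k < \<rho>" for k
  proof -
    show "0 < t k" using \<rho> by (simp add: t_def)
    have "\<rho> * 1 < \<rho> * 2 ^ (k + 1)"
      using \<rho> by (intro mult_strict_left_mono one_less_power) auto
    then show "t k < \<rho>" by (simp add: t_def divide_simps)
  qed
  have t_le: "t j \<le> t k / 2" if "k < j" for j k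
  proof -
    have "(2::real) ^ (k + 2) \<le> 2 ^ (j + 1)" using that by (intro power_increasing) auto
    then have "\<rho> / 2 ^ (j + 1) \<le> \<rho> / 2 ^ (k + 2)" using \<rho> by (intro divide_left_mono) auto
    then show ?thesis by (simp add: t_def)
  qed
  have near: "3 / 4 * t k < norm (x - y)" "norm (x - y) < 5 / 4 * t k" if "y \<in> b k" for y k
  proof -
    have w: "norm (x + t k *\<^sub>R e - y) < \<epsilon> * t k / 2"
      using that by (simp add: b_def dist_norm)
    have "\<epsilon> * t k \<le> 1 / 2 * t k" using \<epsilon>(2) t(1)[of k] by (intro mult_right_mono) auto
    then have w': "norm (x + t k *\<^sub>R e - y) < t k / 4" using w by simp
    have te: "norm (t k *\<^sub>R e) = t k" using e t(1)[of k] by simp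
    have "norm (x - y) \<le> norm (x + t k *\<^sub>R e - y) + norm (t k *\<^sub>R e)"
      using norm_triangle_ineq4[of "x + t k *\<^sub>R e - y" "t k *\<^sub>R e"] by simp
    then show "norm (x - y) < 5 / 4 * t k" using w' te by simp
    have "norm (t k *\<^sub>R e) \<le> norm (x + t k *\<^sub>R e - y) + norm (x - y)"
      using norm_triangle_ineq4[of "x + t k *\<^sub>R e - y" "x - y"] by simp
    then show "3 / 4 * t k < norm (x - y)" using w' te by simp
  qed
  \<comment> \<open>Consecutive scales differ by a factor 2, which exceeds the ratio 5/3 of the radii of each shell.\<close>
  have disj: "\<not> (y \<in> b k \<and> y \<in> b j)" if "k < j" for y j k
    using near[of y k] near[of y j] t_le[OF that] t(1)[of k] by auto
  have pairs: "(x, y) \<in> inward_pairs (\<epsilon> / 4) \<Omega>" if "y \<in> b k" "k < n" for y k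
  proof -
    have "ball y (\<epsilon> * t k / 2) \<subseteq> ball (x + t k *\<^sub>R e) (\<epsilon> * t k)"
    proof
      fix z assume "z \<in> ball y (\<epsilon> * t k / 2)"
      then show "z \<in> ball (x + t k *\<^sub>R e) (\<epsilon> * t k)"
        using that(1) dist_triangle[of "x + t k *\<^sub>R e" z y] by (simp add: b_def)
    qed
    also have sub: "\<dots> \<subseteq> \<Omega>" using t[of k] by (rule cone)
    finally have s: "ball y (\<epsilon> * t k / 2) \<subseteq> \<Omega>" .
    then have "y \<in> \<Omega>" using \<epsilon>(1) t(1)[of k] by (simp add: subset_iff)
    have "\<epsilon> * t k / 2 \<le> bdist \<Omega> y" using assms(1,2) s by (rule bdist_ge_radius)
    moreover have "\<epsilon> * norm (x - y) \<le> \<epsilon> * (2 * t k)"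
      using near(2)[OF that(1)] \<epsilon>(1) t(1)[of k] by (intro mult_left_mono) auto
    ultimately have "\<epsilon> / 4 * norm (x - y) \<le> bdist \<Omega> y" by simp
    moreover have "bdist \<Omega> x < norm (x - y)"
    proof -
      have "(2::real) ^ (k + 1) \<le> 2 ^ n" using that(2) by (intro power_increasing) auto
      then have "\<rho> / 2 ^ n \<le> t k" unfolding t_def using \<rho> by (intro divide_left_mono) auto
      moreover have "bdist \<Omega> x \<le> \<rho> / 2 ^ n / 2" using scale that(2) by simp
      ultimately show ?thesis using near(1)[OF that(1)] t(1)[of k] by simp
    qed
    moreover have "norm (x - y) < 1" using near(2)[OF that(1)] t(2)[of k] \<rho>(2) by simp
    ultimately show ?thesis using \<open>x \<in> \<Omega>\<close> \<open>y \<in> \<Omega>\<close> by (simp add: inward_pairs_def)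
  qed
  define a where "a = (\<epsilon> / 4) ^ CARD('n) * unit_ball_vol (real CARD('n))"
  define m where "m k = 1 / (2 * t k) ^ CARD('n)" for k
  have m: "0 \<le> m k" for k using t(1)[of k] by (simp add: m_def)
  have b_int: "(\<integral>\<^sup>+y. ennreal (m k) * indicator (b k) y \<partial>lebesgue) = ennreal a" for k
  proof -
    have "b k \<in> sets borel" by (simp add: b_def)
    then have "(\<integral>\<^sup>+y. ennreal (m k) * indicator (b k) y \<partial>lebesgue) = ennreal (m k) * emeasure lborel (b k)"
      by (simp add: nn_integral_cmult_indicator nn_integral_completion)
    also have "\<dots> = ennreal (m k * (unit_ball_vol (real CARD('n)) * (\<epsilon> * t k / 2) ^ CARD('n)))"
      unfolding b_def using \<epsilon>(1) t(1)[of k] m[of k] by (simp add: emeasure_ball ennreal_mult)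
    also have "m k * (unit_ball_vol (real CARD('n)) * (\<epsilon> * t k / 2) ^ CARD('n)) = a"
    proof -
      have "(\<epsilon> * t k / 2) ^ CARD('n) = (\<epsilon> / 4) ^ CARD('n) * (2 * t k) ^ CARD('n)"
        unfolding power_mult_distrib[symmetric] by simp
      then show ?thesis using t(1)[of k] by (simp add: m_def a_def)
    qed
    finally show ?thesis .
  qed
  have le: "(\<Sum>k<n. ennreal (m k) * indicator (b k) y) \<le> inward_kernel (\<epsilon> / 4) \<Omega> (x, y)" for y
  proof (cases "\<exists>k<n. y \<in> b k")
    case True
    then obtain k where k: "k < n" "y \<in> b k" by blast
    have "(\<Sum>j<n. ennreal (m j) * indicator (b j) y) = (\<Sum>j\<in>{k}. ennreal (m j) * indicator (b j) y)"
    proof (rule sum.mono_neutral_right)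
      show "\<forall>i\<in>{..<n} - {k}. ennreal (m i) * indicator (b i) y = 0"
        using disj k(2) by (metis DiffE indicator_simps(2) insert_iff linorder_neqE_nat mult_zero_right)
    qed (use k in auto)
    also have "\<dots> = ennreal (m k)" using k by simp
    also have "\<dots> \<le> ennreal (1 / norm (x - y) ^ CARD('n))"
    proof (rule ennreal_leI)
      have pos: "0 < norm (x - y)" "norm (x - y) \<le> 2 * t k"
        using near[OF k(2)] t(1)[of k] by auto
      then show "m k \<le> 1 / norm (x - y) ^ CARD('n)"
        unfolding m_def using t(1)[of k]
        by (intro divide_left_mono power_mono mult_pos_pos zero_less_power) auto
    qed
    finally show ?thesis using pairs[OF k(2,1)] by (simp add: inward_kernel_def)
  next
    case False
    then have "(\<Sum>k<n. ennreal (m k) * indicator (b k) y) = 0" by (intro sum.neutral) auto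
    then show ?thesis by simp
  qed
  have "ennreal (real n * a) = (\<Sum>k<n. ennreal a)"
    by (simp add: ennreal_mult'' ennreal_of_nat_eq_real_of_nat a_def \<epsilon>(1) less_imp_le)
  also have "\<dots> = (\<integral>\<^sup>+y. (\<Sum>k<n. ennreal (m k) * indicator (b k) y) \<partial>lebesgue)"
  proof (subst nn_integral_sum)
    have "b k \<in> sets lebesgue" for k by (simp add: b_def)
    then show "(\<lambda>y. ennreal (m k) * indicator (b k) y) \<in> borel_measurable lebesgue" for k
      by measurable
  qed (simp add: b_int)
  also have "\<dots> \<le> (\<integral>\<^sup>+y. inward_kernel (\<epsilon> / 4) \<Omega> (x, y) \<partial>lebesgue)"
    by (intro nn_integral_mono le)
  finally show ?thesis unfolding a_def .
qed

text \<open>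
  The number of dyadic scales between \<^term>\<open>d\<close> and \<^term>\<open>\<rho>\<close>, up to a bounded error. The case
  $n = 0$ covers a \<^term>\<open>d\<close> that is too large for any scale to fit.
\<close>

lemma ex_dyadic_scale:
  fixes d \<rho> :: real
  assumes "0 < d" "0 < \<rho>"
  obtains n :: nat where "n = 0 \<or> d \<le> \<rho> / 2 ^ (n + 1)" "ln_plus (1 / d) \<le> real n + (2 + \<bar>ln \<rho>\<bar>)"
proof -
  let ?P = "\<lambda>n. \<rho> / 2 ^ (n + 2) < d"
  obtain m where "\<rho> / d < 2 ^ m" using real_arch_pow[of 2 "\<rho> / d"] by auto
  also have "\<dots> \<le> (2::real) ^ (m + 2)" by (intro power_increasing) auto
  finally have "?P m" using assms by (simp add: field_simps)
  define n where "n = (LEAST n. ?P n)"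
  have Pn: "?P n" unfolding n_def by (rule LeastI) fact
  have "n = 0 \<or> d \<le> \<rho> / 2 ^ (n + 1)"
  proof (cases n)
    case (Suc k)
    then have "\<not> ?P k" unfolding n_def by (intro not_less_Least) simp
    then show ?thesis by (simp add: Suc)
  qed simp
  moreover have "ln_plus (1 / d) \<le> real n + (2 + \<bar>ln \<rho>\<bar>)"
  proof -
    have "1 / d \<le> 2 ^ (n + 2) / \<rho>" using Pn assms by (simp add: field_simps)
    then have "ln (1 / d) \<le> ln (2 ^ (n + 2) / \<rho>)" using assms by (intro ln_mono) auto
    also have "\<dots> = (real n + 2) * ln 2 - ln \<rho>"
      using assms ln_realpow[of 2 "n + 2"] by (subst ln_div) (auto simp: algebra_simps)
    also have "\<dots> \<le> (real n + 2) * 1 + \<bar>ln \<rho>\<bar>"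
    proof -
      have "(real n + 2) * ln 2 \<le> (real n + 2) * 1"
        using ln_le_minus_one[of 2] by (intro mult_left_mono) auto
      then show ?thesis by linarith
    qed
    finally show ?thesis by (simp add: ln_plus_def)
  qed
  ultimately show thesis using that by blast
qed

text \<open>
  Close to the boundary this combines the count of scales with the mass at each scale. Away from it
  the logarithm is bounded by the constant \<open>\<bar>ln \<delta>\<bar>\<close>, which the summand 1 absorbs.
\<close>

lemma ln_plus_bdist_le_inward_kernel:
  fixes \<Omega> :: "(real ^ 'n) set"
  assumes \<Omega>: "bounded_Lipschitz_open \<Omega>" and fr: "frontier \<Omega> \<noteq> {}"
  obtains c A where "0 < c" "0 < A" "\<And>x. x \<in> \<Omega> \<Longrightarrow> ennreal (ln_plus (1 / bdist \<Omega> x))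
    \<le> ennreal A * (1 + (\<integral>\<^sup>+y. inward_kernel c \<Omega> (x, y) \<partial>lebesgue))"
proof -
  have op: "open \<Omega>" using \<Omega> by (simp add: bounded_Lipschitz_open_def)
  obtain \<epsilon>0 \<rho>0 \<delta> where 0: "0 < \<epsilon>0" "0 < \<rho>0" "0 < \<delta>"
      "interior_cones \<Omega> {x. bdist \<Omega> x < \<delta>} \<epsilon>0 \<rho>0"
    using Lipschitz_interior_cones[OF \<Omega>] .
  define \<epsilon> where "\<epsilon> = min \<epsilon>0 (1 / 2)"
  define \<rho> where "\<rho> = min \<rho>0 (1 / 2)"
  have \<epsilon>: "0 < \<epsilon>" "\<epsilon> \<le> 1 / 2" and \<rho>: "0 < \<rho>" "\<rho> \<le> 1 / 2"
    using 0 by (auto simp: \<epsilon>_def \<rho>_def)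
  have cones: "interior_cones \<Omega> {x. bdist \<Omega> x < \<delta>} \<epsilon> \<rho>"
    using 0(4) by (rule interior_cones_mono) (auto simp: \<epsilon>_def \<rho>_def)
  define a where "a = (\<epsilon> / 4) ^ CARD('n) * unit_ball_vol (real CARD('n))"
  have a: "0 < a" using \<epsilon> by (simp add: a_def)
  define A where "A = 1 / a + (2 + \<bar>ln \<rho>\<bar>) + \<bar>ln \<delta>\<bar>"
  have A: "1 / a \<le> A" "2 + \<bar>ln \<rho>\<bar> \<le> A" "\<bar>ln \<delta>\<bar> \<le> A" "0 < A"
    using a by (auto simp: A_def add_pos_nonneg)
  have "ennreal (ln_plus (1 / bdist \<Omega> x))
    \<le> ennreal A * (1 + (\<integral>\<^sup>+y. inward_kernel (\<epsilon> / 4) \<Omega> (x, y) \<partial>lebesgue))"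
    (is "_ \<le> _ * (1 + ?I)") if x: "x \<in> \<Omega>" for x
  proof (cases "bdist \<Omega> x < \<delta>")
    case True
    have d: "0 < bdist \<Omega> x" using op fr x by (rule bdist_pos)
    obtain e where e: "norm e = 1" 
        "\<And>t. 0 < t \<Longrightarrow> t < \<rho> \<Longrightarrow> ball (x + t *\<^sub>R e) (\<epsilon> * t) \<subseteq> \<Omega>"
      using cones x True unfolding interior_cones_def by blast
    obtain n where n: "n = 0 \<or> bdist \<Omega> x \<le> \<rho> / 2 ^ (n + 1)"
        "ln_plus (1 / bdist \<Omega> x) \<le> real n + (2 + \<bar>ln \<rho>\<bar>)"
      using ex_dyadic_scale[OF d \<rho>(1)] .
    have I: "ennreal (real n * a) \<le> ?I"
      unfolding a_def using nn_integral_inward_kernel_ge[OF op fr \<epsilon> \<rho> x e n(1)] .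
    have "ln_plus (1 / bdist \<Omega> x) \<le> 1 / a * (real n * a) + A"
      using n(2) A(2) a by simp
    also have "\<dots> \<le> A * (real n * a) + A"
      using A(1) a by (intro add_right_mono mult_right_mono) auto
    also have "\<dots> = A * (1 + real n * a)" by (simp add: algebra_simps)
    finally have "ennreal (ln_plus (1 / bdist \<Omega> x)) \<le> ennreal (A * (1 + real n * a))"
      by (rule ennreal_leI)
    also have "\<dots> = ennreal A * (1 + ennreal (real n * a))"
      using A(4) a by (simp add: ennreal_mult ennreal_plus)
    also have "\<dots> \<le> ennreal A * (1 + ?I)"
      by (intro mult_left_mono add_left_mono I) simp
    finally show ?thesis .
  next
    case False
    then have "ln (1 / bdist \<Omega> x) \<le> ln (1 / \<delta>)"
      using 0(3) by (intro ln_mono) (auto intro!: divide_left_mono)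
    also have "\<dots> \<le> \<bar>ln \<delta>\<bar>" using 0(3) by (simp add: ln_div)
    finally have "ln_plus (1 / bdist \<Omega> x) \<le> A" using A(3,4) by (simp add: ln_plus_def)
    then have "ennreal (ln_plus (1 / bdist \<Omega> x)) \<le> ennreal A * 1" by (simp add: ennreal_leI)
    also have "\<dots> \<le> ennreal A * (1 + ?I)" by (intro mult_left_mono) auto
    finally show ?thesis .
  qed
  then show thesis using that[of "\<epsilon> / 4" A] \<epsilon> A(4) by simp
qed

section \<open>The logarithmic inequality\<close>

theorem theorem1p2:
  fixes \<Omega> :: "(real ^ 'n) set" and p :: real
  assumes "bounded_Lipschitz_open \<Omega>" and "\<Omega> \<noteq> {}" and "1 \<le> p"
  shows "\<exists>c::real. c > 0 \<and> (\<forall>u \<in> Lp_on p \<Omega>.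
           (\<integral>\<^sup>+ x\<in>\<Omega>. ennreal (\<bar>u x\<bar> powr p * ln_plus (1 / bdist \<Omega> x)) \<partial>lebesgue)
           \<le> ennreal c *
              ((\<integral>\<^sup>+ z\<in>{(x, y). x \<in> \<Omega> \<and> y \<in> \<Omega> \<and> norm (x - y) < 1}.
                  (case z of (x, y) \<Rightarrow>
                     ennreal (\<bar>u x - u y\<bar> powr p / norm (x - y) ^ CARD('n)))
                  \<partial>(lebesgue \<Otimes>\<^sub>M lebesgue))
               + (\<integral>\<^sup>+ x\<in>\<Omega>. ennreal (\<bar>u x\<bar> powr p) \<partial>lebesgue)))"
proof -
  have op: "open \<Omega>" and bd: "bounded \<Omega>"
    using assms(1) by (auto simp: bounded_Lipschitz_open_def)
  have fr: "frontier \<Omega> \<noteq> {}"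
    using bd assms(2) not_bounded_UNIV unfolding frontier_eq_empty by auto
  obtain c A where c: "0 < c" and A: "0 < A"
    and pointwise: "\<And>x. x \<in> \<Omega> \<Longrightarrow> ennreal (ln_plus (1 / bdist \<Omega> x))
      \<le> ennreal A * (1 + (\<integral>\<^sup>+y. inward_kernel c \<Omega> (x, y) \<partial>lebesgue))"
    using ln_plus_bdist_le_inward_kernel[OF assms(1) fr] by blast
  define B where "B = (2 / c) ^ CARD('n) * unit_ball_vol (real CARD('n))"
  have B: "0 \<le> B" using c by (simp add: B_def)
  have sf: "sigma_finite_measure (lebesgue :: (real ^ 'n) measure)"
    by (rule sigma_finite_measure_completion) unfold_locales
  have "(id :: real ^ 'n \<Rightarrow> _) \<in> lebesgue \<rightarrow>\<^sub>M borel"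
    by (intro measurable_completion) simp
  note this[unfolded id_def, measurable]
  have "(\<lambda>z :: (real ^ 'n) \<times> (real ^ 'n). (fst z, snd z)) \<in> lebesgue \<Otimes>\<^sub>M lebesgue \<rightarrow>\<^sub>M borel \<Otimes>\<^sub>M borel"
    by measurable
  then have "(\<lambda>z :: (real ^ 'n) \<times> (real ^ 'n). z) \<in> lebesgue \<Otimes>\<^sub>M lebesgue \<rightarrow>\<^sub>M borel"
    by (simp add: borel_prod)
  from measurable_compose[OF this borel_measurable_inward_kernel[OF op]]
  have k[measurable]: "inward_kernel c \<Omega> \<in> borel_measurable (lebesgue \<Otimes>\<^sub>M lebesgue)"
    by simp
  define C where "C = A * (1 + 2 powr p * (1 + B))"
  have "(\<integral>\<^sup>+ x\<in>\<Omega>. ennreal (\<bar>u x\<bar> powr p * ln_plus (1 / bdist \<Omega> x)) \<partial>lebesgue)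
       \<le> ennreal C *
          ((\<integral>\<^sup>+ z\<in>{(x, y). x \<in> \<Omega> \<and> y \<in> \<Omega> \<and> norm (x - y) < 1}.
              (case z of (x, y) \<Rightarrow> ennreal (\<bar>u x - u y\<bar> powr p / norm (x - y) ^ CARD('n)))
              \<partial>(lebesgue \<Otimes>\<^sub>M lebesgue))
           + (\<integral>\<^sup>+ x\<in>\<Omega>. ennreal (\<bar>u x\<bar> powr p) \<partial>lebesgue))"
    (is "?lhs \<le> _ * (?D + ?N)") if u: "u \<in> Lp_on p \<Omega>" for u
  proof -
    \<comment> \<open>The function is measurable only on the set, so it is extended by zero before Tonelli's theorem applies.\<close>
    define v where "v x = (if x \<in> \<Omega> then u x else 0)" for x
    have v[measurable]: "v \<in> borel_measurable lebesgue"
      unfolding v_def using u op by (intro borel_measurable_if_I) (auto simp: Lp_on_def)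
    have N: "?N = (\<integral>\<^sup>+ x. ennreal (\<bar>v x\<bar> powr p) \<partial>lebesgue)"
      by (intro nn_integral_cong) (auto simp: v_def indicator_def)
    let ?I = "\<lambda>x. \<integral>\<^sup>+y. inward_kernel c \<Omega> (x, y) \<partial>lebesgue"
    have [measurable]: "?I \<in> borel_measurable lebesgue"
      by (rule sigma_finite_measure.borel_measurable_nn_integral_fst[OF sf k])
    have "?lhs \<le> (\<integral>\<^sup>+x. ennreal A * (ennreal (\<bar>v x\<bar> powr p) + ennreal (\<bar>v x\<bar> powr p) * ?I x) \<partial>lebesgue)"
    proof (rule nn_integral_mono)
      fix x
      show "ennreal (\<bar>u x\<bar> powr p * ln_plus (1 / bdist \<Omega> x)) * indicator \<Omega> x
        \<le> ennreal A * (ennreal (\<bar>v x\<bar> powr p) + ennreal (\<bar>v x\<bar> powr p) * ?I x)"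
      proof (cases "x \<in> \<Omega>")
        case True
        then have "ennreal (\<bar>u x\<bar> powr p * ln_plus (1 / bdist \<Omega> x)) * indicator \<Omega> x
          = ennreal (\<bar>v x\<bar> powr p) * ennreal (ln_plus (1 / bdist \<Omega> x))"
          by (simp add: v_def ennreal_mult ln_plus_def)
        also have "\<dots> \<le> ennreal (\<bar>v x\<bar> powr p) * (ennreal A * (1 + ?I x))"
          by (intro mult_left_mono pointwise True) simp
        also have "\<dots> = ennreal A * (ennreal (\<bar>v x\<bar> powr p) + ennreal (\<bar>v x\<bar> powr p) * ?I x)"
          by (simp add: distrib_left mult.left_commute mult.commute)
        finally show ?thesis .
      qed simp
    qed
    also have "\<dots> = ennreal A * (?N + (\<integral>\<^sup>+x. ennreal (\<bar>v x\<bar> powr p) * ?I x \<partial>lebesgue))"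
      unfolding N by (subst nn_integral_cmult, measurable, subst nn_integral_add, measurable)
    also have "(\<integral>\<^sup>+x. ennreal (\<bar>v x\<bar> powr p) * ?I x \<partial>lebesgue) \<le> ennreal (2 powr p) *
       ((\<integral>\<^sup>+z. ennreal (\<bar>v (fst z) - v (snd z)\<bar> powr p) * inward_kernel c \<Omega> z \<partial>(lebesgue \<Otimes>\<^sub>M lebesgue))
        + ennreal B * ?N)"
      unfolding N B_def using assms(3)
      by (intro nn_integral_powr_times_kernel_le sf v k nn_integral_inward_kernel_le op fr c) simp
    also have "(\<integral>\<^sup>+z. ennreal (\<bar>v (fst z) - v (snd z)\<bar> powr p) * inward_kernel c \<Omega> z
        \<partial>(lebesgue \<Otimes>\<^sub>M lebesgue)) \<le> ?D"
      by (intro nn_integral_mono)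
        (auto simp: inward_kernel_def inward_pairs_def v_def split: split_indicator
          simp flip: ennreal_mult)
    also have "ennreal A * (?N + ennreal (2 powr p) * (?D + ennreal B * ?N))
        \<le> ennreal A * ((?D + ?N) + ennreal (2 powr p) * ((?D + ?N) + ennreal B * (?D + ?N)))"
      by (intro mult_left_mono add_mono) auto
    also have "\<dots> = ennreal C * (?D + ?N)"
      using A B by (simp add: C_def ennreal_mult ennreal_plus distrib_right distrib_left mult.assoc
          del: add.assoc)
    finally show ?thesis
      by (simp add: add_left_mono mult_left_mono)
  qed
  moreover have "0 < C" using A B by (simp add: C_def add_pos_nonneg)
  ultimately show ?thesis by blast
qed

end
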